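(* For every positive integer $d$ there exists a constant $C_d$ such that $M_{1,d}(n) \leq C_d n$ for all $n$.
   Context: For a finite set $S \subset \mathbb{R}^d$, the Vietoris–Rips complex $R(S)$ is the simplicial complex on vertex set $S$ whose faces are all subsets of $S$ of (Euclidean) diameter at most $1$. For a fixed field $\mathbf{k}$, $\tilde{\beta}_p(\Gamma)=\dim_{\mathbf{k}}\tilde{H}_p(\Gamma;\mathbf{k})$ denotes the $p$-th reduced Betti number. Define $M_{p,d}(n) := \max\{\tilde{\beta}_p(R(S)) : S \subset \mathbb{R}^d,\ |S| \leq n\}$. *)

theory Defs
  imports "HOL-Analysis.Analysis" "HOL-Algebra.AbelCoset" "Jordan_Normal_Form.VS_Connect" "HOL-Library.Function_Algebras"
begin

definition vietoris_rips :: "'v::metric_space set \<Rightarrow> 'v set set" where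
  "vietoris_rips S = {\<sigma>. \<sigma> \<subseteq> S \<and> diameter \<sigma> \<le> 1}"

text \<open>
  An oriented \<open>p\<close>-chain of a simplicial complex \<open>\<Gamma>\<close> is an alternating function on oriented
  \<open>p\<close>-simplices: \<open>c [v\<^sub>0, \<dots>, v\<^sub>p]\<close> is the coefficient of the simplex \<open>{v\<^sub>0, \<dots>, v\<^sub>p}\<close> with the
  orientation given by this ordering of its vertices.
\<close>

definition simplicial_chains :: "'v set set \<Rightarrow> nat \<Rightarrow> ('v list \<Rightarrow> 'k::field) set" where
  "simplicial_chains \<Gamma> p =
    {c. (\<forall>xs. c xs \<noteq> 0 \<longrightarrow> length xs = Suc p \<and> distinct xs \<and> set xs \<in> \<Gamma>) \<and>
        (\<forall>xs i j. i < j \<longrightarrow> j < length xs \<longrightarrow> c (xs[i := xs ! j, j := xs ! i]) = - c xs)}"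

text \<open>
  This is \<open>\<partial>[v\<^sub>0, \<dots>, v\<^sub>p] = (\<Sum>i\<le>p. (-1)\<^sup>i [v\<^sub>0, \<dots>, v\<^sub>i\<^sub>-\<^sub>1, v\<^sub>i\<^sub>+\<^sub>1, \<dots>, v\<^sub>p])\<close> read off coefficientwise: an
  oriented simplex having \<open>[xs]\<close> as a facet can be written, up to orientation, as \<open>[v, xs]\<close>, and
  then \<open>[xs]\<close> occurs in its boundary with sign \<open>+1\<close>. On \<open>0\<close>-chains the value at \<open>[]\<close> is the
  augmentation, so the resulting homology is the reduced one.
\<close>

definition boundary :: "'v set set \<Rightarrow> ('v list \<Rightarrow> 'k::field) \<Rightarrow> 'v list \<Rightarrow> 'k" where
  "boundary \<Gamma> c xs = (\<Sum>v\<in>\<Union>\<Gamma>. c (v # xs))"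

definition cycles :: "'v set set \<Rightarrow> nat \<Rightarrow> ('v list \<Rightarrow> 'k::field) set" where
  "cycles \<Gamma> p = {c \<in> simplicial_chains \<Gamma> p. boundary \<Gamma> c = 0}"

definition boundaries :: "'v set set \<Rightarrow> nat \<Rightarrow> ('v list \<Rightarrow> 'k::field) set" where
  "boundaries \<Gamma> p = boundary \<Gamma> ` simplicial_chains \<Gamma> (Suc p)"

definition function_module :: "('a \<Rightarrow> 'k::field) set \<Rightarrow> ('k, 'a \<Rightarrow> 'k) module" where
  "function_module W =
    \<lparr>carrier = W, mult = undefined, one = undefined, zero = 0, add = (+),
     smult = (\<lambda>a f x. a * f x)\<rparr>"

definition quotient_module :: "('k, 'a) module \<Rightarrow> 'a set \<Rightarrow> ('k, 'a set) module" where
  "quotient_module M N =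
    \<lparr>carrier = a_rcosets\<^bsub>M\<^esub> N, mult = undefined, one = undefined, zero = N, add = set_add M,
     smult = (\<lambda>a X. \<Union>x\<in>X. N +>\<^bsub>M\<^esub> (a \<odot>\<^bsub>M\<^esub> x))\<rparr>"

definition reduced_homology :: "'v set set \<Rightarrow> nat \<Rightarrow> ('k::field, ('v list \<Rightarrow> 'k) set) module" where
  "reduced_homology \<Gamma> p = quotient_module (function_module (cycles \<Gamma> p)) (boundaries \<Gamma> p)"

lemma coset_function_module: "N +>\<^bsub>function_module W\<^esub> f = (\<lambda>n. n + f) ` N"
  by (auto simp: a_r_coset_def r_coset_def function_module_def)

lemma rcosets_function_module:
  "a_rcosets\<^bsub>function_module W\<^esub> N = (\<lambda>f. (\<lambda>n. n + f) ` N) ` W"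
  by (auto simp: A_RCOSETS_def RCOSETS_def r_coset_def function_module_def image_def)

lemma set_add_function_module:
  "X <+>\<^bsub>function_module W\<^esub> Y = {x + y | x y. x \<in> X \<and> y \<in> Y}"
  by (auto simp: set_add_def set_mult_def function_module_def)

lemma vectorspace_quotient_function_module:
  fixes W N :: "('a \<Rightarrow> 'k::field) set"
  assumes W: "0 \<in> W" "\<And>f g. f \<in> W \<Longrightarrow> g \<in> W \<Longrightarrow> f + g \<in> W" "\<And>a f. f \<in> W \<Longrightarrow> (\<lambda>x. a * f x) \<in> W"
    and N: "0 \<in> N" "\<And>f g. f \<in> N \<Longrightarrow> g \<in> N \<Longrightarrow> f + g \<in> N" "\<And>a f. f \<in> N \<Longrightarrow> (\<lambda>x. a * f x) \<in> N"
  shows "vectorspace (class_ring :: 'k ring) (quotient_module (function_module W) N)"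
proof -
  let ?Q = "quotient_module (function_module W) N"
  define q where "q f = (\<lambda>n. n + f) ` N" for f
  have car: "carrier ?Q = q ` W"
    by (simp add: quotient_module_def rcosets_function_module q_def)
  have uN: "- f \<in> N" if "f \<in> N" for f using N(3)[OF that, of "-1"] by (simp add: fun_Compl_def)
  have uW: "- f \<in> W" if "f \<in> W" for f using W(3)[OF that, of "-1"] by (simp add: fun_Compl_def)
  have mem: "g \<in> q f \<longleftrightarrow> g - f \<in> N" for f g
  proof
    assume "g - f \<in> N"
    then have "(g - f) + f \<in> q f" unfolding q_def by (rule imageI)
    then show "g \<in> q f" by simp
  qed (auto simp: q_def)
  have zero: "zero ?Q = q 0" by (simp add: quotient_module_def q_def)
  have eq: "q f = q g" if "f - g \<in> N" for f g
  proof -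
    have "h - f \<in> N \<longleftrightarrow> h - g \<in> N" for h
      using N(2)[OF _ that, of "h - f"] N(2)[OF _ uN[OF that], of "h - g"] by auto
    then show ?thesis by (auto simp: mem)
  qed
  have add: "q f \<oplus>\<^bsub>?Q\<^esub> q g = q (f + g)" for f g
  proof -
    have "q f \<oplus>\<^bsub>?Q\<^esub> q g = {x + y | x y. x - f \<in> N \<and> y - g \<in> N}"
      by (simp add: quotient_module_def set_add_function_module mem)
    also have "\<dots> = q (f + g)"
    proof (intro Set.set_eqI iffI)
      fix h assume "h \<in> {x + y | x y. x - f \<in> N \<and> y - g \<in> N}"
      then obtain x y where *: "h = x + y" "x - f \<in> N" "y - g \<in> N" by auto
      have "h - (f + g) = (x - f) + (y - g)" by (simp add: * algebra_simps)
      then show "h \<in> q (f + g)" using N(2)[OF *(2,3)] mem by metis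
    next
      fix h assume "h \<in> q (f + g)"
      then have "(h - g) - f \<in> N" by (simp add: mem algebra_simps)
      moreover have "h = (h - g) + g" "g - g \<in> N" using N(1) by simp_all
      ultimately show "h \<in> {x + y | x y. x - f \<in> N \<and> y - g \<in> N}" by blast
    qed
    finally show ?thesis .
  qed
  have sm: "a \<odot>\<^bsub>?Q\<^esub> q f = q (\<lambda>x. a * f x)" for a f
  proof -
    have "a \<odot>\<^bsub>?Q\<^esub> q f = (\<Union>g\<in>q f. q (\<lambda>x. a * g x))"
      by (simp add: quotient_module_def coset_function_module q_def) (simp add: function_module_def)
    also have "\<dots> = (\<Union>g\<in>q f. q (\<lambda>x. a * f x))"
    proof (intro SUP_cong refl eq)
      fix g assume "g \<in> q f"
      then have "(\<lambda>x. a * (g - f) x) \<in> N" using N(3) mem by blast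
      moreover have "(\<lambda>x. a * (g - f) x) = (\<lambda>x. a * g x) - (\<lambda>x. a * f x)"
        by (auto simp: fun_eq_iff algebra_simps)
      ultimately show "(\<lambda>x. a * g x) - (\<lambda>x. a * f x) \<in> N" by simp
    qed
    also have "\<dots> = q (\<lambda>x. a * f x)" using N(1) mem[of f f] by auto
    finally show ?thesis .
  qed
  have distr: "(\<lambda>x. a * (f + g) x) = (\<lambda>x. a * f x) + (\<lambda>x. a * g x)"
      "(\<lambda>x. (a + b) * f x) = (\<lambda>x. a * f x) + (\<lambda>x. b * f x)" for a b and f g :: "'a \<Rightarrow> 'k"
    by (auto simp: fun_eq_iff algebra_simps)
  have "module (class_ring :: 'k ring) ?Q"
  proof (rule module_criteria)
    show "cring (class_ring :: 'k ring)" by (rule class_cring.is_cring)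
    show "\<forall>v\<in>carrier ?Q. \<exists>neg_v\<in>carrier ?Q. v \<oplus>\<^bsub>?Q\<^esub> neg_v = \<zero>\<^bsub>?Q\<^esub>"
    proof
      fix v assume "v \<in> carrier ?Q"
      then obtain f where "v = q f" "f \<in> W" by (auto simp: car)
      then show "\<exists>neg_v\<in>carrier ?Q. v \<oplus>\<^bsub>?Q\<^esub> neg_v = \<zero>\<^bsub>?Q\<^esub>"
        using uW by (auto simp: car add zero intro!: bexI[of _ "- f"])
    qed
  next
    show "\<forall>a b v. a \<in> carrier class_ring \<and> b \<in> carrier class_ring \<and> v \<in> carrier ?Q \<longrightarrow>
        (a \<oplus>\<^bsub>class_ring\<^esub> b) \<odot>\<^bsub>?Q\<^esub> v = a \<odot>\<^bsub>?Q\<^esub> v \<oplus>\<^bsub>?Q\<^esub> b \<odot>\<^bsub>?Q\<^esub> v"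
      unfolding car by (auto simp: add sm distr(2))
    show "\<forall>a v w. a \<in> carrier class_ring \<and> v \<in> carrier ?Q \<and> w \<in> carrier ?Q \<longrightarrow>
        a \<odot>\<^bsub>?Q\<^esub> (v \<oplus>\<^bsub>?Q\<^esub> w) = a \<odot>\<^bsub>?Q\<^esub> v \<oplus>\<^bsub>?Q\<^esub> a \<odot>\<^bsub>?Q\<^esub> w"
      unfolding car by (auto simp: add sm distr(1) simp del: plus_fun_apply)
    show "\<forall>a b v. a \<in> carrier class_ring \<and> b \<in> carrier class_ring \<and> v \<in> carrier ?Q \<longrightarrow>
        (a \<otimes>\<^bsub>class_ring\<^esub> b) \<odot>\<^bsub>?Q\<^esub> v = a \<odot>\<^bsub>?Q\<^esub> (b \<odot>\<^bsub>?Q\<^esub> v)"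
      unfolding car by (auto simp: sm mult.assoc)
    show "\<forall>c v. c \<in> carrier class_ring \<and> v \<in> carrier ?Q \<longrightarrow> c \<odot>\<^bsub>?Q\<^esub> v \<in> carrier ?Q"
      unfolding car by (auto simp: sm intro!: imageI W(3))
    show "\<forall>v w. v \<in> carrier ?Q \<and> w \<in> carrier ?Q \<longrightarrow> v \<oplus>\<^bsub>?Q\<^esub> w \<in> carrier ?Q"
      unfolding car by (auto simp: add intro!: imageI W(2))
    show "\<zero>\<^bsub>?Q\<^esub> \<in> carrier ?Q"
      unfolding car zero using W(1) by (rule imageI)
    show "\<forall>v w. v \<in> carrier ?Q \<and> w \<in> carrier ?Q \<longrightarrow> v \<oplus>\<^bsub>?Q\<^esub> w = w \<oplus>\<^bsub>?Q\<^esub> v"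
      unfolding car by (auto simp: add add.commute)
    show "\<forall>v w x. v \<in> carrier ?Q \<and> w \<in> carrier ?Q \<and> x \<in> carrier ?Q \<longrightarrow>
        v \<oplus>\<^bsub>?Q\<^esub> w \<oplus>\<^bsub>?Q\<^esub> x = v \<oplus>\<^bsub>?Q\<^esub> (w \<oplus>\<^bsub>?Q\<^esub> x)"
      unfolding car by (auto simp: add add.assoc)
    show "\<forall>v\<in>carrier ?Q. v \<oplus>\<^bsub>?Q\<^esub> \<zero>\<^bsub>?Q\<^esub> = v"
      unfolding car zero by (auto simp: add)
    show "\<forall>v\<in>carrier ?Q. \<one>\<^bsub>class_ring\<^esub> \<odot>\<^bsub>?Q\<^esub> v = v"
      unfolding car by (auto simp: sm)
  qed
  then show ?thesis by (simp add: vectorspace_def class_field)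
qed

lemma simplicial_chains_supportD:
  "c \<in> simplicial_chains \<Gamma> p \<Longrightarrow> c xs \<noteq> 0 \<Longrightarrow> length xs = Suc p \<and> distinct xs \<and> set xs \<in> \<Gamma>"
  by (simp add: simplicial_chains_def)

lemma simplicial_chains_swapD:
  "c \<in> simplicial_chains \<Gamma> p \<Longrightarrow> i < j \<Longrightarrow> j < length xs \<Longrightarrow>
    c (xs[i := xs ! j, j := xs ! i]) = - c xs"
  by (simp add: simplicial_chains_def)

lemma simplicial_chains_0: "0 \<in> simplicial_chains \<Gamma> p" by (simp add: simplicial_chains_def)

lemma simplicial_chains_add:
  assumes c: "c \<in> simplicial_chains \<Gamma> p" and d: "d \<in> simplicial_chains \<Gamma> p"
  shows "c + d \<in> simplicial_chains \<Gamma> p"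
proof -
  have "length xs = Suc p \<and> distinct xs \<and> set xs \<in> \<Gamma>" if "(c + d) xs \<noteq> 0" for xs
  proof -
    from that have "c xs \<noteq> 0 \<or> d xs \<noteq> 0" by auto
    then show ?thesis
      using simplicial_chains_supportD[OF c] simplicial_chains_supportD[OF d] by blast
  qed
  moreover have "(c + d) (xs[i := xs ! j, j := xs ! i]) = - (c + d) xs"
    if "i < j" "j < length xs" for xs i j
    using simplicial_chains_swapD[OF c that] simplicial_chains_swapD[OF d that] by simp
  ultimately show ?thesis unfolding simplicial_chains_def by blast
qed

lemma simplicial_chains_smult:
  "c \<in> simplicial_chains \<Gamma> p \<Longrightarrow> (\<lambda>xs. a * c xs) \<in> simplicial_chains \<Gamma> p"
  by (simp add: simplicial_chains_def)

lemma boundary_add: "boundary \<Gamma> (c + d) = boundary \<Gamma> c + boundary \<Gamma> d"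
  by (simp add: boundary_def fun_eq_iff sum.distrib)

lemma boundary_smult: "boundary \<Gamma> (\<lambda>xs. a * c xs) = (\<lambda>xs. a * boundary \<Gamma> c xs)"
  by (simp add: boundary_def fun_eq_iff sum_distrib_left)

lemma boundary_0: "boundary \<Gamma> 0 = 0"
  by (simp add: boundary_def fun_eq_iff)

lemma boundary_in_chains:
  assumes down: "\<And>\<sigma> \<tau>. \<sigma> \<in> \<Gamma> \<Longrightarrow> \<tau> \<subseteq> \<sigma> \<Longrightarrow> \<tau> \<in> \<Gamma>" and c: "c \<in> simplicial_chains \<Gamma> (Suc p)"
  shows "boundary \<Gamma> c \<in> simplicial_chains \<Gamma> p"
proof -
  have "length xs = Suc p \<and> distinct xs \<and> set xs \<in> \<Gamma>" if nz: "boundary \<Gamma> c xs \<noteq> 0" for xs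
  proof -
    obtain v where "c (v # xs) \<noteq> 0"
      using nz unfolding boundary_def by (rule sum.not_neutral_contains_not_neutral)
    then have "length (v # xs) = Suc (Suc p) \<and> distinct (v # xs) \<and> set (v # xs) \<in> \<Gamma>"
      by (rule simplicial_chains_supportD[OF c])
    then show ?thesis using down[of "set (v # xs)" "set xs"] by auto
  qed
  moreover have "boundary \<Gamma> c (xs[i := xs ! j, j := xs ! i]) = - boundary \<Gamma> c xs"
    if "i < j" "j < length xs" for xs i j
  proof -
    have "c (v # xs[i := xs ! j, j := xs ! i]) = - c (v # xs)" for v
    proof -
      have "c ((v # xs)[Suc i := (v # xs) ! Suc j, Suc j := (v # xs) ! Suc i]) = - c (v # xs)"
        by (rule simplicial_chains_swapD[OF c]) (use that in auto)
      then show ?thesis by simp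
    qed
    then show ?thesis by (simp add: boundary_def sum_negf)
  qed
  ultimately show ?thesis by (auto simp: simplicial_chains_def)
qed

lemma boundary_boundary:
  assumes c: "c \<in> simplicial_chains \<Gamma> (Suc p)"
  shows "boundary \<Gamma> (boundary \<Gamma> c) = (0 :: 'v list \<Rightarrow> 'k::field)"
proof
  fix xs
  have alt: "c (v # w # xs) = - c (w # v # xs)" for v w
  proof -
    have "c ((w # v # xs)[0 := (w # v # xs) ! 1, 1 := (w # v # xs) ! 0]) = - c (w # v # xs)"
      by (rule simplicial_chains_swapD[OF c]) auto
    then show ?thesis by simp
  qed
  have dia: "c (v # v # xs) = 0" for v
    using simplicial_chains_supportD[OF c, of "v # v # xs"] by auto
  have key: "finite A \<Longrightarrow> (\<Sum>w\<in>A. \<Sum>v\<in>A. c (v # w # xs)) = 0" for A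
  proof (induction A rule: finite_induct)
    case (insert a A)
    have "(\<Sum>w\<in>insert a A. \<Sum>v\<in>insert a A. c (v # w # xs))
        = (\<Sum>v\<in>A. c (v # a # xs)) + (\<Sum>w\<in>A. c (a # w # xs))"
      using insert by (simp add: sum.distrib dia)
    also have "\<dots> = (\<Sum>v\<in>A. c (v # a # xs) + c (a # v # xs))" by (simp add: sum.distrib)
    also have "\<dots> = 0" by (intro sum.neutral ballI) (subst alt, simp)
    finally show ?case .
  qed simp
  show "boundary \<Gamma> (boundary \<Gamma> c) xs = 0 xs"
    using key[of "\<Union>\<Gamma>"] by (cases "finite (\<Union>\<Gamma>)") (auto simp: boundary_def)
qed

lemma vectorspace_reduced_homology:
  assumes "\<And>\<sigma> \<tau>. \<sigma> \<in> \<Gamma> \<Longrightarrow> \<tau> \<subseteq> \<sigma> \<Longrightarrow> \<tau> \<in> \<Gamma>"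
  shows "vectorspace (class_ring :: 'k::field ring) (reduced_homology \<Gamma> p)"
    and "(boundaries \<Gamma> p :: (_ \<Rightarrow> 'k) set) \<subseteq> cycles \<Gamma> p"
proof -
  show "(boundaries \<Gamma> p :: (_ \<Rightarrow> 'k) set) \<subseteq> cycles \<Gamma> p"
    using boundary_in_chains[OF assms] boundary_boundary by (force simp: boundaries_def cycles_def)
  show "vectorspace (class_ring :: 'k::field ring) (reduced_homology \<Gamma> p)"
    unfolding reduced_homology_def
  proof (rule vectorspace_quotient_function_module)
    fix f g :: "'a list \<Rightarrow> 'k" and a :: 'k
    show "f + g \<in> boundaries \<Gamma> p" if "f \<in> boundaries \<Gamma> p" "g \<in> boundaries \<Gamma> p"
      using that unfolding boundaries_def by (auto simp flip: boundary_add intro!: imageI simplicial_chains_add)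
    show "(\<lambda>x. a * f x) \<in> boundaries \<Gamma> p" if "f \<in> boundaries \<Gamma> p"
      using that unfolding boundaries_def by (auto simp flip: boundary_smult intro!: imageI simplicial_chains_smult)
    show "0 \<in> boundaries \<Gamma> p"
      unfolding boundaries_def using boundary_0 simplicial_chains_0 by (metis image_eqI)
  qed (auto simp: cycles_def simplicial_chains_0 simplicial_chains_add simplicial_chains_smult
      boundary_0 boundary_add boundary_smult fun_eq_iff)
qed

definition reduced_betti :: "'k::field itself \<Rightarrow> nat \<Rightarrow> 'v set set \<Rightarrow> nat" where
  "reduced_betti _ p \<Gamma> =
    vectorspace.dim (class_ring :: 'k ring) (reduced_homology \<Gamma> p :: ('k, ('v list \<Rightarrow> 'k) set) module)"

definition max_betti :: "'k::field itself \<Rightarrow> 'd::finite itself \<Rightarrow> nat \<Rightarrow> nat \<Rightarrow> nat" where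
  "max_betti K _ p n =
    Max {reduced_betti K p (vietoris_rips S) | S :: (real ^ 'd) set. finite S \<and> card S \<le> n}"

end

theory Submission
  imports Defs
begin

text \<open>
  Build \<open>S\<close> up one point at a time. When a point \<open>v\<close> is added, choose in the set \<open>L\<close> of its
  neighbours a maximal subset \<open>R\<close> of points at pairwise distance more than \<open>1\<close>; a packing argument
  bounds \<open>card R\<close> by a constant depending only on the dimension. Each neighbour \<open>w\<close> is within
  distance \<open>1\<close> of some \<open>\<rho> w \<in> R\<close>, so \<open>[v, w, \<rho> w]\<close> is a (possibly degenerate) simplex and,
  modulo its boundary, the edge \<open>[v, w]\<close> may be traded for \<open>[v, \<rho> w]\<close> and an edge avoiding \<open>v\<close>.
  Hence a cycle on which the \<open>card R\<close> functionals \<open>z \<mapsto> (\<Sum>w | \<rho> w = r. z [v, w])\<close> vanish is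
  homologous to a cycle avoiding \<open>v\<close>, and the first Betti number grows by at most \<open>card R\<close>.
\<close>

section \<open>Linear algebra: common kernels and dimensions of quotients\<close>

text \<open>Imposing one more functional lowers the dimension of the kernel by at most one, so a
  single extra generator per functional suffices.\<close>

lemma (in vector_space) span_common_kernel:
  assumes "finite R" and Z: "subspace Z"
    and \<phi>_add: "\<And>r x y. \<phi> r (x + y) = \<phi> r x + (\<phi> r y :: 'a)"
    and \<phi>_scale: "\<And>r a x. \<phi> r (scale a x) = a * \<phi> r x"
  shows "\<exists>T. finite T \<and> card T \<le> card R \<and> T \<subseteq> Z \<and>
    Z \<subseteq> span (T \<union> {x \<in> Z. \<forall>r\<in>R. \<phi> r x = 0})"
  using \<open>finite R\<close>
proof (induction R rule: finite_induct)
  case empty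
  show ?case by (intro exI[of _ "{}"]) (auto intro: span_base)
next
  case (insert r R)
  let ?K = "\<lambda>R. {x \<in> Z. \<forall>r\<in>R. \<phi> r x = 0}"
  obtain T where T: "finite T" "card T \<le> card R" "T \<subseteq> Z" "Z \<subseteq> span (T \<union> ?K R)"
    using insert.IH by blast
  show ?case
  proof (cases "\<forall>x\<in>?K R. \<phi> r x = 0")
    case True
    then have "?K (insert r R) = ?K R" by auto
    then show ?thesis using T insert.hyps by (intro exI[of _ T]) auto
  next
    case False
    then obtain t where t: "t \<in> ?K R" "\<phi> r t \<noteq> 0" by blast
    let ?U = "span (insert t T \<union> ?K (insert r R))"
    have "x \<in> ?U" if x: "x \<in> ?K R" for x
    proof -
      \<comment> \<open>This coefficient makes \<open>\<phi> r\<close> vanish on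
        \<open>x + scale a t\<close>, so \<open>x\<close> differs from an element of the smaller
        kernel by a multiple of \<open>t\<close>.\<close>
      define a where "a = - (\<phi> r x / \<phi> r t)"
      have "a * \<phi> r t = - \<phi> r x" using t by (simp add: a_def)
      then have "x + scale a t \<in> ?K (insert r R)"
        using x t Z by (auto simp: \<phi>_add \<phi>_scale subspace_add subspace_scale)
      then have "x + scale a t \<in> ?U" by (blast intro: span_base)
      moreover have "scale a t \<in> ?U" by (blast intro: span_base span_scale)
      ultimately have "(x + scale a t) - scale a t \<in> ?U" by (rule span_diff)
      then show ?thesis by simp
    qed
    moreover have "T \<subseteq> ?U" by (blast intro: span_base)
    ultimately have "span (T \<union> ?K R) \<subseteq> ?U" by (intro span_minimal subspace_span) blast
    moreover have "card (insert t T) \<le> card (insert r R)"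
      using T insert.hyps by (simp add: card_insert_if)
    ultimately show ?thesis using T t by (intro exI[of _ "insert t T"]) auto
  qed
qed

text \<open>Pointwise operations make the type-based \<open>span\<close> and \<open>subspace\<close>
  available for chains, whereas Betti numbers are dimensions of carrier-based modules.\<close>

interpretation fun_space: vector_space "\<lambda>(a::'k::field) (f::'a \<Rightarrow> 'k) x. a * f x"
  by unfold_locales (auto simp: fun_eq_iff algebra_simps)

text \<open>The bridge from spans of functions to the carrier-based dimension: modulo
  \<open>N\<close> the images of \<open>T\<close> generate, and a generating set has at least
  \<open>dim\<close> elements.\<close>

lemma dim_quotient_function_module_le:
  fixes W N :: "('a \<Rightarrow> 'k::field) set"
  assumes W: "fun_space.subspace W" and N: "fun_space.subspace N"
    and T: "finite T" "T \<subseteq> W" and span: "W \<subseteq> fun_space.span (T \<union> N)"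
  shows "vectorspace.dim (class_ring :: 'k ring) (quotient_module (function_module W) N) \<le> card T"
proof -
  let ?Q = "quotient_module (function_module W) N"
  interpret Q: vectorspace "class_ring :: 'k ring" ?Q
    by (rule vectorspace_quotient_function_module)
      (use W N in \<open>auto simp: fun_space.subspace_def\<close>)
  \<comment> \<open>The quotient map; the facts that follow make it linear for the operations of
    \<open>?Q\<close>.\<close>
  define q where "q f = (\<lambda>n. n + f) ` N" for f
  have car: "carrier ?Q = q ` W"
    by (simp add: quotient_module_def rcosets_function_module q_def)
  have mem: "g \<in> q f \<longleftrightarrow> g - f \<in> N" for f g
    unfolding q_def by (force simp: image_iff)
  have eq: "q f = q g" if "f - g \<in> N" for f g
  proof -
    have "h - f \<in> N \<longleftrightarrow> h - g \<in> N" for h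
      using fun_space.subspace_add[OF N _ that, of "h - f"]
        fun_space.subspace_diff[OF N _ that, of "h - g"] by auto
    then show ?thesis by (auto simp: mem)
  qed
  have zero: "\<zero>\<^bsub>?Q\<^esub> = q 0" by (simp add: quotient_module_def q_def)
  have add: "q f \<oplus>\<^bsub>?Q\<^esub> q g = q (f + g)" for f g
  proof -
    have "q f \<oplus>\<^bsub>?Q\<^esub> q g = {x + y | x y. x - f \<in> N \<and> y - g \<in> N}"
      by (simp add: quotient_module_def set_add_function_module mem)
    also have "\<dots> = q (f + g)"
    proof (intro Set.set_eqI iffI)
      fix h assume "h \<in> {x + y | x y. x - f \<in> N \<and> y - g \<in> N}"
      then obtain x y where *: "h = x + y" "x - f \<in> N" "y - g \<in> N" by auto
      have "h - (f + g) = (x - f) + (y - g)" by (simp add: * algebra_simps)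
      then show "h \<in> q (f + g)" using fun_space.subspace_add[OF N *(2,3)] mem by metis
    next
      fix h assume "h \<in> q (f + g)"
      then have "(h - g) - f \<in> N" by (simp add: mem algebra_simps)
      moreover have "h = (h - g) + g" "g - g \<in> N"
        using fun_space.subspace_0[OF N] by simp_all
      ultimately show "h \<in> {x + y | x y. x - f \<in> N \<and> y - g \<in> N}" by blast
    qed
    finally show ?thesis .
  qed
  have smult: "a \<odot>\<^bsub>?Q\<^esub> q f = q (\<lambda>x. a * f x)" for a f
  proof -
    \<comment> \<open>The scalar multiple is a union over all representatives of the coset;
      \<open>eq\<close> shows that they all yield the same coset.\<close>
    have "a \<odot>\<^bsub>?Q\<^esub> q f = (\<Union>g\<in>q f. q (\<lambda>x. a * g x))"
      by (simp add: quotient_module_def coset_function_module q_def) (simp add: function_module_def)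
    also have "\<dots> = (\<Union>g\<in>q f. q (\<lambda>x. a * f x))"
    proof (intro SUP_cong refl eq)
      fix g assume "g \<in> q f"
      then show "(\<lambda>x. a * g x) - (\<lambda>x. a * f x) \<in> N"
        using fun_space.subspace_scale[OF N, of "g - f" a]
        by (simp add: mem fun_space.scale_right_diff_distrib del: minus_apply)
    qed
    also have "\<dots> = q (\<lambda>x. a * f x)"
      using fun_space.subspace_0[OF N] mem[of f f] by auto
    finally show ?thesis .
  qed
  have TQ: "q ` T \<subseteq> carrier ?Q" using T car by auto
  have sub: "submodule class_ring (Q.span (q ` T)) ?Q" by (rule Q.span_is_submodule[OF TQ])
  have zero_mem: "q 0 \<in> Q.span (q ` T)"
    using submodule.zero_closed[OF sub] zero by simp
  \<comment> \<open>Pulling the span back along \<open>q\<close> gives a subspace of functions, to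
    which minimality of the span of \<open>T \<union> N\<close> applies.\<close>
  let ?U = "{f. q f \<in> Q.span (q ` T)}"
  have "fun_space.subspace ?U"
  proof (rule fun_space.subspaceI)
    show "0 \<in> ?U" using zero_mem by simp
    show "f + g \<in> ?U" if "f \<in> ?U" "g \<in> ?U" for f g
      using submodule.m_closed[OF sub, of "q f" "q g"] that add[of f g] by simp
    show "(\<lambda>x. a * f x) \<in> ?U" if "f \<in> ?U" for a f
      using submodule.smult_closed[OF sub, of a "q f"] that smult[of a f] by simp
  qed
  moreover have "T \<union> N \<subseteq> ?U"
  proof -
    have "q f = q 0" if "f \<in> N" for f using that by (intro eq) simp
    then show ?thesis using Q.in_own_span[OF TQ] zero_mem by auto
  qed
  ultimately have "W \<subseteq> ?U" using span fun_space.span_minimal by blast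
  then have "Q.span (q ` T) = carrier ?Q"
    using Q.span_is_subset2[OF TQ] car by auto
  then have "Q.dim \<le> card (q ` T)" using T TQ by (intro Q.gen_ge_dim) auto
  also have "\<dots> \<le> card T" by (rule card_image_le[OF T(1)])
  finally show ?thesis .
qed

section \<open>Subspaces of chains; oriented edges and triangles\<close>

lemma subspace_cycles: "fun_space.subspace (cycles \<Gamma> p)"
  by (auto simp: fun_space.subspace_def cycles_def simplicial_chains_0 simplicial_chains_add
      simplicial_chains_smult boundary_0 boundary_add boundary_smult fun_eq_iff)

lemma subspace_boundaries: "fun_space.subspace (boundaries \<Gamma> p)"
proof (rule fun_space.subspaceI)
  show "0 \<in> boundaries \<Gamma> p"
    unfolding boundaries_def using boundary_0 simplicial_chains_0 by (metis image_eqI)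
  show "f + g \<in> boundaries \<Gamma> p" if "f \<in> boundaries \<Gamma> p" "g \<in> boundaries \<Gamma> p" for f g
    using that unfolding boundaries_def
    by (auto simp flip: boundary_add intro!: imageI simplicial_chains_add)
  show "(\<lambda>xs. a * f xs) \<in> boundaries \<Gamma> p" if "f \<in> boundaries \<Gamma> p" for a f
    using that unfolding boundaries_def
    by (auto simp flip: boundary_smult intro!: imageI simplicial_chains_smult)
qed

text \<open>The oriented edge [a, b] as an alternating function; it is zero for
  \<open>a = b\<close>, so degenerate edges need no separate treatment.\<close>

definition edge_chain :: "'v \<Rightarrow> 'v \<Rightarrow> 'v list \<Rightarrow> 'k::field" where
  "edge_chain a b xs = of_bool (xs = [a, b]) - of_bool (xs = [b, a])"

text \<open>The oriented triangle [a, b, c]: even orderings (the rotations) count positively, odd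
  ones negatively.\<close>

definition triangle_chain :: "'v \<Rightarrow> 'v \<Rightarrow> 'v \<Rightarrow> 'v list \<Rightarrow> 'k::field" where
  "triangle_chain a b c xs =
    of_bool (xs = [a, b, c]) + of_bool (xs = [b, c, a]) + of_bool (xs = [c, a, b])
    - of_bool (xs = [b, a, c]) - of_bool (xs = [a, c, b]) - of_bool (xs = [c, b, a])"

lemma triangle_chain_in_chains:
  assumes "distinct [a, b, c]" "{a, b, c} \<in> \<Gamma>"
  shows "(triangle_chain a b c :: _ \<Rightarrow> 'k::field) \<in> simplicial_chains \<Gamma> 2"
proof -
  have "length xs = Suc 2 \<and> distinct xs \<and> set xs \<in> \<Gamma>" if "triangle_chain a b c xs \<noteq> (0::'k)" for xs
  proof -
    have "xs \<in> {[a, b, c], [b, c, a], [c, a, b], [b, a, c], [a, c, b], [c, b, a]}"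
      by (rule ccontr) (use that in \<open>simp add: triangle_chain_def\<close>)
    moreover from this have "set xs = {a, b, c}" by auto
    ultimately show ?thesis using assms by auto
  qed
  moreover have "triangle_chain a b c (xs[i := xs ! j, j := xs ! i]) = - (triangle_chain a b c xs :: 'k)"
    if ij: "i < j" "j < length xs" for xs i j
  proof (cases "length xs = 3")
    case True
    then obtain x y z where xs: "xs = [x, y, z]"
      by (auto simp: numeral_3_eq_3 length_Suc_conv)
    consider "i = 0" "j = 1" | "i = 0" "j = 2" | "i = 1" "j = 2"
      using ij True by linarith
    then show ?thesis
      by cases (auto simp: xs triangle_chain_def numeral_2_eq_2 conj_ac)
  next
    case False
    then have "length (xs[i := xs ! j, j := xs ! i]) \<noteq> 3" by simp
    with False have "xs \<noteq> [u, v, w]" "xs[i := xs ! j, j := xs ! i] \<noteq> [u, v, w]" for u v w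
      by (metis length_Cons list.size(3) numeral_3_eq_3)+
    then show ?thesis by (simp add: triangle_chain_def)
  qed
  ultimately show ?thesis unfolding simplicial_chains_def by blast
qed

text \<open>The boundary sums over a prepended vertex, so each ordering contributes its tail. The
  two orderings that start with \<open>a\<close> leave \<open>edge_chain b c\<close>, and cyclically
  for \<open>b\<close> and \<open>c\<close>.\<close>

lemma boundary_triangle_chain:
  assumes "finite (\<Union>\<Gamma>)" "{a, b, c} \<in> \<Gamma>"
  shows "boundary \<Gamma> (triangle_chain a b c) =
    (edge_chain a b + edge_chain b c + edge_chain c a :: 'v list \<Rightarrow> 'k::field)"
proof
  fix xs :: "'v list"
  have V: "a \<in> \<Union>\<Gamma>" "b \<in> \<Union>\<Gamma>" "c \<in> \<Union>\<Gamma>" using assms(2) by blast+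
  have "(of_bool (v # xs = u # ys) :: 'k) = (if v = u then of_bool (xs = ys) else 0)" for u v ys
    by simp
  then show "boundary \<Gamma> (triangle_chain a b c) xs =
      (edge_chain a b + edge_chain b c + edge_chain c a :: 'v list \<Rightarrow> 'k) xs"
    using assms(1) V
    by (simp add: boundary_def triangle_chain_def edge_chain_def sum.distrib sum_subtractf
        del: list.inject Union_iff)
qed

text \<open>The case \<open>b = c\<close> is included because a neighbour may be its own net point;
  the outer edges then cancel and the middle one is zero.\<close>

lemma triangle_boundary_in_boundaries:
  assumes "finite (\<Union>\<Gamma>)" "{a, b, c} \<in> \<Gamma>" "a \<noteq> b" "a \<noteq> c"
  shows "(edge_chain a b + edge_chain b c + edge_chain c a :: 'v list \<Rightarrow> 'k::field) \<in> boundaries \<Gamma> 1"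
proof (cases "b = c")
  case True
  then have "edge_chain a b + edge_chain b c + edge_chain c a = (0 :: 'v list \<Rightarrow> 'k)"
    by (simp add: edge_chain_def fun_eq_iff)
  then show ?thesis using fun_space.subspace_0[OF subspace_boundaries] by metis
next
  case False
  then have "(triangle_chain a b c :: _ \<Rightarrow> 'k) \<in> simplicial_chains \<Gamma> (Suc 1)"
    using assms triangle_chain_in_chains[of a b c \<Gamma>] by (simp add: numeral_2_eq_2)
  then show ?thesis
    unfolding boundaries_def boundary_triangle_chain[OF assms(1,2), symmetric] by (rule imageI)
qed

section \<open>Vietoris-Rips complexes and inclusions of complexes\<close>

text \<open>Finiteness gives boundedness, by which \<open>diameter\<close> dominates every distance.
  The empty set has \<open>diameter\<close> 0 and counts as a face.\<close>

lemma vietoris_rips_iff: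
  assumes "finite S"
  shows "\<sigma> \<in> vietoris_rips S \<longleftrightarrow> \<sigma> \<subseteq> S \<and> (\<forall>x\<in>\<sigma>. \<forall>y\<in>\<sigma>. dist x y \<le> 1)"
proof -
  have "diameter \<sigma> \<le> 1 \<longleftrightarrow> (\<forall>x\<in>\<sigma>. \<forall>y\<in>\<sigma>. dist x y \<le> 1)" if "\<sigma> \<subseteq> S"
  proof
    have "bounded \<sigma>" using that assms finite_imp_bounded finite_subset by blast
    then show "\<forall>x\<in>\<sigma>. \<forall>y\<in>\<sigma>. dist x y \<le> 1" if "diameter \<sigma> \<le> 1"
      using that diameter_bounded_bound order_trans by blast
    show "diameter \<sigma> \<le> 1" if "\<forall>x\<in>\<sigma>. \<forall>y\<in>\<sigma>. dist x y \<le> 1"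
      using that by (auto simp: diameter_def intro!: cSUP_least)
  qed
  then show ?thesis by (auto simp: vietoris_rips_def)
qed

lemma Union_vietoris_rips: "finite S \<Longrightarrow> \<Union>(vietoris_rips S) = S"
  by (auto simp: vietoris_rips_iff intro!: bexI[of _ "{_}"])

lemma vietoris_rips_down_closed:
  "finite S \<Longrightarrow> \<sigma> \<in> vietoris_rips S \<Longrightarrow> \<tau> \<subseteq> \<sigma> \<Longrightarrow> \<tau> \<in> vietoris_rips S"
  by (auto simp: vietoris_rips_iff)

lemma simplicial_chains_mono: "\<Gamma> \<subseteq> \<Delta> \<Longrightarrow> simplicial_chains \<Gamma> p \<subseteq> simplicial_chains \<Delta> p"
  unfolding simplicial_chains_def by blast

text \<open>In this encoding the inclusion of complexes is the identity on chains: a chain of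
  \<open>\<Gamma>\<close> vanishes on lists with a vertex outside, so the extra vertices only add
  zeros.\<close>

lemma boundary_mono:
  assumes "\<Gamma> \<subseteq> \<Delta>" "finite (\<Union>\<Delta>)" and c: "c \<in> simplicial_chains \<Gamma> p"
  shows "boundary \<Delta> c = boundary \<Gamma> c"
proof
  fix xs
  have "c (v # xs) = 0" if "v \<notin> \<Union>\<Gamma>" for v
    using simplicial_chains_supportD[OF c, of "v # xs"] that by fastforce
  then show "boundary \<Delta> c xs = boundary \<Gamma> c xs"
    unfolding boundary_def using assms(1,2) by (intro sum.mono_neutral_right) auto
qed

lemma cycles_mono:
  assumes "\<Gamma> \<subseteq> \<Delta>" "finite (\<Union>\<Delta>)"
  shows "cycles \<Gamma> p \<subseteq> (cycles \<Delta> p :: ('a list \<Rightarrow> 'b::field) set)"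
proof
  fix c :: "'a list \<Rightarrow> 'b" assume "c \<in> cycles \<Gamma> p"
  then have c: "c \<in> simplicial_chains \<Gamma> p" "boundary \<Gamma> c = 0" by (auto simp: cycles_def)
  then show "c \<in> cycles \<Delta> p"
    using simplicial_chains_mono[OF assms(1)] boundary_mono[OF assms c(1)] by (auto simp: cycles_def)
qed

lemma boundaries_mono:
  assumes "\<Gamma> \<subseteq> \<Delta>" "finite (\<Union>\<Delta>)"
  shows "boundaries \<Gamma> p \<subseteq> boundaries \<Delta> p"
  unfolding boundaries_def
proof (rule image_subsetI)
  fix c assume c: "c \<in> simplicial_chains \<Gamma> (Suc p)"
  then have "c \<in> simplicial_chains \<Delta> (Suc p)" using simplicial_chains_mono[OF assms(1)] by blast
  then show "boundary \<Gamma> c \<in> boundary \<Delta> ` simplicial_chains \<Delta> (Suc p)"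
    unfolding boundary_mono[OF assms c, symmetric] by (rule imageI)
qed

text \<open>By alternation \<open>z\<close> vanishes on [x, v] as well, so no edge in its support
  contains \<open>v\<close>.\<close>

lemma cycle_avoiding_vertex:
  assumes S: "finite S" and z: "z \<in> cycles (vietoris_rips (insert v S)) 1"
    and v: "\<And>x. z [v, x] = 0"
  shows "z \<in> cycles (vietoris_rips S) 1"
proof -
  let ?\<Delta> = "vietoris_rips (insert v S)"
  have fin: "finite (insert v S)" using S by simp
  have ch: "z \<in> simplicial_chains ?\<Delta> 1" and bd: "boundary ?\<Delta> z = 0"
    using z by (auto simp: cycles_def)
  have v': "z [x, v] = 0" for x
    using simplicial_chains_swapD[OF ch, of 0 1 "[v, x]"] v by simp
  have "set xs \<in> vietoris_rips S" if nz: "z xs \<noteq> 0" for xs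
  proof -
    have *: "length xs = 2" "set xs \<in> ?\<Delta>" using simplicial_chains_supportD[OF ch nz] by auto
    then obtain x y where xs: "xs = [x, y]" by (auto simp: numeral_2_eq_2 length_Suc_conv)
    have "x \<noteq> v" "y \<noteq> v" using nz v v' by (auto simp: xs)
    then show ?thesis using * by (auto simp: xs vietoris_rips_iff[OF S] vietoris_rips_iff[OF fin])
  qed
  then have ch': "z \<in> simplicial_chains (vietoris_rips S) 1"
    using ch unfolding simplicial_chains_def by blast
  have "boundary ?\<Delta> z = boundary (vietoris_rips S) z"
  proof (rule boundary_mono[OF _ _ ch'])
    show "vietoris_rips S \<subseteq> ?\<Delta>" by (auto simp: vietoris_rips_def)
    show "finite (\<Union>?\<Delta>)" by (simp only: Union_vietoris_rips[OF fin] fin)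
  qed
  with bd ch' show ?thesis by (simp add: cycles_def)
qed

section \<open>Adding points one at a time\<close>

text \<open>Greedy choice: a point joins the net exactly when no chosen point is within \<epsilon>,
  and it then covers itself since \<epsilon> is nonnegative.\<close>

lemma separated_net_exists:
  fixes L :: "'a::metric_space set"
  assumes "finite L" and \<epsilon>: "0 \<le> \<epsilon>"
  shows "\<exists>R\<subseteq>L. (\<forall>x\<in>R. \<forall>y\<in>R. x \<noteq> y \<longrightarrow> dist x y > \<epsilon>) \<and> (\<forall>w\<in>L. \<exists>r\<in>R. dist w r \<le> \<epsilon>)"
  using assms(1)
proof (induction L rule: finite_induct)
  case (insert w L)
  then obtain R where R: "R \<subseteq> L" "\<forall>x\<in>R. \<forall>y\<in>R. x \<noteq> y \<longrightarrow> dist x y > \<epsilon>"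
    "\<forall>w\<in>L. \<exists>r\<in>R. dist w r \<le> \<epsilon>" by blast
  show ?case
  proof (cases "\<exists>r\<in>R. dist w r \<le> \<epsilon>")
    case True
    then show ?thesis using R by (intro exI[of _ R]) auto
  next
    case False
    then show ?thesis using R by (intro exI[of _ "insert w R"]) (auto simp: dist_commute not_le \<epsilon>)
  qed
qed simp

text \<open>Modulo boundaries, the cycles killed by the functionals come from the old complex;
  \<open>T\<close> pays only for the functionals, one for each net point.\<close>

lemma cycles_insert_spanned:
  fixes S :: "'v::metric_space set"
  assumes S: "finite S" and v: "v \<notin> S"
    and packing: "\<forall>R. (\<forall>x\<in>R. dist v x \<le> 1) \<longrightarrow>
      (\<forall>x\<in>R. \<forall>y\<in>R. x \<noteq> y \<longrightarrow> dist x y > 1) \<longrightarrow> card R \<le> N"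
  defines "\<Delta> \<equiv> vietoris_rips (insert v S)"
  shows "\<exists>T::('v list \<Rightarrow> 'k::field) set. finite T \<and> card T \<le> N \<and> T \<subseteq> cycles \<Delta> 1 \<and>
    cycles \<Delta> 1 \<subseteq> fun_space.span (T \<union> (cycles (vietoris_rips S) 1 \<union> boundaries \<Delta> 1))"
proof -
  \<comment> \<open>The vertices of the link of \<open>v\<close>.\<close>
  define L where "L = {w \<in> S. dist v w \<le> 1}"
  have L: "finite L" "v \<notin> L" using S v by (auto simp: L_def)
  have fin: "finite (insert v S)" using S by simp
  have fin\<Delta>: "finite (\<Union>\<Delta>)" unfolding \<Delta>_def by (simp only: Union_vietoris_rips[OF fin] fin)
  obtain R where R: "R \<subseteq> L" "\<forall>x\<in>R. \<forall>y\<in>R. x \<noteq> y \<longrightarrow> dist x y > 1"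
    "\<forall>w\<in>L. \<exists>r\<in>R. dist w r \<le> 1"
    using separated_net_exists[OF L(1), of 1] by auto
  obtain \<rho> where \<rho>: "\<And>w. w \<in> L \<Longrightarrow> \<rho> w \<in> R \<and> dist w (\<rho> w) \<le> 1"
    using bchoice[OF R(3)[unfolded Bex_def]] by blast
  have cardR: "card R \<le> N" proof -
    have "\<forall>x\<in>R. dist v x \<le> 1" using R(1) by (auto simp: L_def)
    then show ?thesis using packing[THEN spec, of R] R(2) by simp
  qed
  \<comment> \<open>The total coefficient that accumulates on [v, r] once every edge [v, w] has been
    moved to [v, \<rho> w].\<close>
  define \<phi> where "\<phi> r z = (\<Sum>w | w \<in> L \<and> \<rho> w = r. z [v, w])" for r and z :: "'v list \<Rightarrow> 'k"
  obtain T where T: "finite T" "card T \<le> card R" "T \<subseteq> cycles \<Delta> 1"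
    "cycles \<Delta> 1 \<subseteq> fun_space.span (T \<union> {z \<in> cycles \<Delta> 1. \<forall>r\<in>R. \<phi> r z = 0})"
  proof -
    have "\<phi> r (x + y) = \<phi> r x + \<phi> r y" "\<phi> r (\<lambda>xs. a * x xs) = a * \<phi> r x" for r x y a
      by (simp_all add: \<phi>_def sum.distrib sum_distrib_left)
    from fun_space.span_common_kernel[OF finite_subset[OF R(1) L(1)] subspace_cycles, of \<phi>, OF this]
    show thesis using that by blast
  qed
  have "z \<in> fun_space.span (cycles (vietoris_rips S) 1 \<union> boundaries \<Delta> 1)"
    if z: "z \<in> cycles \<Delta> 1" and \<phi>z: "\<forall>r\<in>R. \<phi> r z = 0" for z
  proof -
    \<comment> \<open>\<open>b w\<close> is the boundary of [v, w, \<rho> w]. Subtracting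
      \<open>z [v, w]\<close> copies of it trades [v, w] for [v, \<rho> w] and [\<rho> w, w];
      \<open>h\<close> collects these corrections.\<close>
    define b :: "'v \<Rightarrow> 'v list \<Rightarrow> 'k" where
      "b w = edge_chain v w + edge_chain w (\<rho> w) + edge_chain (\<rho> w) v" for w
    define h where "h = (\<Sum>w\<in>L. (\<lambda>xs. z [v, w] * b w xs))"
    have b: "b w \<in> boundaries \<Delta> 1" if w: "w \<in> L" for w
    proof -
      have "\<rho> w \<in> L" using \<rho>[OF w] R(1) by blast
      then have "{v, w, \<rho> w} \<in> \<Delta>"
        using w \<rho>[OF w] unfolding \<Delta>_def vietoris_rips_iff[OF fin] by (auto simp: L_def dist_commute)
      then show ?thesis unfolding b_def using w \<open>\<rho> w \<in> L\<close> L(2)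
        by (intro triangle_boundary_in_boundaries fin\<Delta>) auto
    qed
    have h: "h \<in> boundaries \<Delta> 1" unfolding h_def
      using b by (intro fun_space.subspace_sum fun_space.subspace_scale subspace_boundaries)
    have "boundaries \<Delta> 1 \<subseteq> (cycles \<Delta> 1 :: ('v list \<Rightarrow> 'k) set)"
      unfolding \<Delta>_def by (rule vectorspace_reduced_homology(2)) (rule vietoris_rips_down_closed[OF fin])
    then have zh: "z - h \<in> cycles \<Delta> 1"
      using z h by (blast intro: fun_space.subspace_diff[OF subspace_cycles])
    have "(z - h) [v, x] = 0" for x
    proof -
      have "h [v, x] = (\<Sum>w\<in>L. z [v, w] * b w [v, x])"
        unfolding h_def by (induction L rule: infinite_finite_induct) auto
      \<comment> \<open>At [v, x] the edge from \<open>w\<close> to \<open>\<rho> w\<close> is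
        invisible, as neither end is \<open>v\<close>; the other two edges give the two
        indicators.\<close>
      also have "\<dots> = (\<Sum>w\<in>L. (if w = x then z [v, w] else 0) - (if \<rho> w = x then z [v, w] else 0))"
      proof (rule sum.cong[OF refl])
        fix w assume "w \<in> L"
        then have "w \<noteq> v" "\<rho> w \<noteq> v" using \<rho> R(1) L(2) by blast+
        then show "z [v, w] * b w [v, x] =
            (if w = x then z [v, w] else 0) - (if \<rho> w = x then z [v, w] else 0)"
          by (auto simp: b_def edge_chain_def)
      qed
      also have "\<dots> = (if x \<in> L then z [v, x] else 0) - \<phi> x z"
        using L(1) by (simp add: sum_subtractf \<phi>_def sum.inter_filter)
      also have "(if x \<in> L then z [v, x] else 0) = z [v, x]"
      proof -
        have "x \<in> L" if nz: "z [v, x] \<noteq> 0"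
        proof -
          have "z \<in> simplicial_chains \<Delta> 1" using z by (simp add: cycles_def)
          from simplicial_chains_supportD[OF this nz] show ?thesis
            by (auto simp: \<Delta>_def vietoris_rips_iff[OF fin] L_def)
        qed
        then show ?thesis by auto
      qed
      \<comment> \<open>Off \<open>R\<close> the fibre of \<open>\<rho>\<close> is empty, so the
        assumption on \<open>R\<close> covers every \<open>x\<close>, and \<open>h\<close> agrees
        with \<open>z\<close> on all edges from \<open>v\<close>.\<close>
      also have "\<phi> x z = 0"
      proof (cases "x \<in> R")
        case False
        then have "{w. w \<in> L \<and> \<rho> w = x} = {}" using \<rho> by blast
        then show ?thesis unfolding \<phi>_def by (simp only: sum.empty)
      qed (use \<phi>z in blast)
      finally show ?thesis by simp
    qed
    then have "z - h \<in> cycles (vietoris_rips S) 1"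
      using cycle_avoiding_vertex[OF S, of "z - h" v] zh unfolding \<Delta>_def by blast
    then have "(z - h) + h \<in> fun_space.span (cycles (vietoris_rips S) 1 \<union> boundaries \<Delta> 1)"
      using h by (intro fun_space.span_add fun_space.span_base) auto
    then show ?thesis by simp
  qed
  then have "T \<union> {z \<in> cycles \<Delta> 1. \<forall>r\<in>R. \<phi> r z = 0} \<subseteq>
      fun_space.span (T \<union> (cycles (vietoris_rips S) 1 \<union> boundaries \<Delta> 1))"
    by (auto intro: fun_space.span_base
        subsetD[OF fun_space.span_mono[of "cycles (vietoris_rips S) 1 \<union> boundaries \<Delta> 1"]])
  then have "cycles \<Delta> 1 \<subseteq> fun_space.span (T \<union> (cycles (vietoris_rips S) 1 \<union> boundaries \<Delta> 1))"
    using T(4) fun_space.span_minimal[OF _ fun_space.subspace_span] by blast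
  then show ?thesis using T cardR by (intro exI[of _ T]) auto
qed

text \<open>Old boundaries remain boundaries in the larger complex, so old generators still work and
  each point adds at most \<open>N\<close>. Keeping \<open>T\<close> inside the cycles lets it
  generate the homology.\<close>

lemma cycles_spanned:
  fixes S :: "'v::metric_space set"
  assumes "finite S"
    and packing: "\<forall>(v::'v) R. (\<forall>x\<in>R. dist v x \<le> 1) \<longrightarrow>
      (\<forall>x\<in>R. \<forall>y\<in>R. x \<noteq> y \<longrightarrow> dist x y > 1) \<longrightarrow> card R \<le> N"
  shows "\<exists>T::('v list \<Rightarrow> 'k::field) set. finite T \<and> card T \<le> N * card S \<and>
    T \<subseteq> cycles (vietoris_rips S) 1 \<and>
    cycles (vietoris_rips S) 1 \<subseteq> fun_space.span (T \<union> boundaries (vietoris_rips S) 1)"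
  using \<open>finite S\<close>
proof (induction S rule: finite_induct)
  case empty
  \<comment> \<open>The only face is the empty one, so there are no edges to support a
    1-chain.\<close>
  have "z = 0" if "z \<in> cycles (vietoris_rips {}) 1" for z :: "'v list \<Rightarrow> 'k"
  proof
    fix xs
    have "z \<in> simplicial_chains (vietoris_rips {}) 1" using that by (simp add: cycles_def)
    from simplicial_chains_supportD[OF this, of xs] show "z xs = 0 xs"
      by (cases "z xs = 0") (auto simp: vietoris_rips_iff)
  qed
  then show ?case by (intro exI[of _ "{}"]) (auto intro: fun_space.span_zero)
next
  case (insert v S)
  let ?\<Gamma> = "vietoris_rips S" and ?\<Delta> = "vietoris_rips (insert v S)"
  have fin: "finite (insert v S)" using insert.hyps by simp
  have fin\<Delta>: "finite (\<Union>?\<Delta>)" by (simp only: Union_vietoris_rips[OF fin] fin)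
  have le: "?\<Gamma> \<subseteq> ?\<Delta>" by (auto simp: vietoris_rips_def)
  obtain T where T: "finite T" "card T \<le> N * card S" "T \<subseteq> (cycles ?\<Gamma> 1 :: ('v list \<Rightarrow> 'k) set)"
    "cycles ?\<Gamma> 1 \<subseteq> fun_space.span (T \<union> boundaries ?\<Gamma> 1)"
    using insert.IH by blast
  obtain T' where T': "finite T'" "card T' \<le> N" "T' \<subseteq> (cycles ?\<Delta> 1 :: ('v list \<Rightarrow> 'k) set)"
    "cycles ?\<Delta> 1 \<subseteq> fun_space.span (T' \<union> (cycles ?\<Gamma> 1 \<union> boundaries ?\<Delta> 1))"
    using cycles_insert_spanned[OF insert.hyps(1,2), of N, OF packing[THEN spec]] by blast
  let ?U = "fun_space.span (T \<union> T' \<union> boundaries ?\<Delta> 1)"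
  have "cycles ?\<Gamma> 1 \<subseteq> ?U"
    using T(4) boundaries_mono[OF le fin\<Delta>, of 1]
      fun_space.span_mono[of "T \<union> boundaries ?\<Gamma> 1" "T \<union> T' \<union> boundaries ?\<Delta> 1"] by blast
  then have "T' \<union> (cycles ?\<Gamma> 1 \<union> boundaries ?\<Delta> 1) \<subseteq> ?U"
    by (auto intro: fun_space.span_base)
  then have "cycles ?\<Delta> 1 \<subseteq> ?U"
    using T'(4) fun_space.span_minimal[OF _ fun_space.subspace_span] by blast
  moreover have "card (T \<union> T') \<le> N * card (insert v S)"
    using card_Un_le[of T T'] T(2) T'(2) insert.hyps by simp
  moreover have "T \<union> T' \<subseteq> cycles ?\<Delta> 1"
    using T(3) T'(3) cycles_mono[OF le fin\<Delta>, of 1] by blast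
  ultimately show ?case using T(1) T'(1) by (intro exI[of _ "T \<union> T'"]) auto
qed

section \<open>Packing in Euclidean space and the linear bound\<close>

text \<open>By compactness finitely many open balls of radius 1/2 cover the unit ball, and each
  holds at most one of the separated points.\<close>

lemma unit_ball_packing:
  "\<exists>N. \<forall>(v::'a::euclidean_space) R. (\<forall>x\<in>R. dist v x \<le> 1) \<longrightarrow>
    (\<forall>x\<in>R. \<forall>y\<in>R. x \<noteq> y \<longrightarrow> dist x y > 1) \<longrightarrow> card R \<le> N"
proof -
  obtain K where K: "finite K" "cball (0::'a) 1 \<subseteq> (\<Union>k\<in>K. ball k (1/2))"
  proof (rule compactE_image[OF compact_cball[of "0::'a" 1], of UNIV "\<lambda>k. ball k (1/2)"])
    have "x \<in> ball x (1/2)" for x :: 'a by simp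
    then show "cball (0::'a) 1 \<subseteq> (\<Union>k. ball k (1/2))" by blast
  qed auto
  have "card R \<le> card K"
    if R: "\<forall>x\<in>R. dist v x \<le> 1" "\<forall>x\<in>R. \<forall>y\<in>R. x \<noteq> y \<longrightarrow> dist x y > 1" for v :: 'a and R
  proof -
    \<comment> \<open>Translating by \<open>v\<close> lets the one cover at the origin serve every
      centre.\<close>
    have "\<exists>k\<in>K. dist (x - v) k < 1/2" if "x \<in> R" for x
    proof -
      have "x - v \<in> cball 0 1" using R(1) that by (simp add: dist_norm norm_minus_commute[of v])
      then show ?thesis using K(2) by (force simp: dist_commute)
    qed
    then obtain f where f: "\<And>x. x \<in> R \<Longrightarrow> f x \<in> K \<and> dist (x - v) (f x) < 1/2" by metis
    have "inj_on f R"
    proof (rule inj_onI, rule ccontr)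
      fix x y assume xy: "x \<in> R" "y \<in> R" "f x = f y" "x \<noteq> y"
      have "dist (x - v) (y - v) < 1"
        using dist_triangle_half_l[of "x - v" "f x" 1 "y - v"] f xy by (metis dist_commute)
      then show False using R(2) xy by (force simp: dist_norm)
    qed
    then show ?thesis using f K(1) by (intro card_inj_on_le) auto
  qed
  then show ?thesis by (intro exI[of _ "card K"]) simp
qed

theorem theorem3p2:
  shows "\<exists>C::real. \<forall>n::nat. real (max_betti TYPE('k::field) TYPE('d::finite) 1 n) \<le> C * real n"
proof -
  \<comment> \<open>The packing number of the unit ball, depending only on the dimension, is the
    constant sought.\<close>
  obtain N where N: "\<forall>(v::real^'d) R. (\<forall>x\<in>R. dist v x \<le> 1) \<longrightarrow>
      (\<forall>x\<in>R. \<forall>y\<in>R. x \<noteq> y \<longrightarrow> dist x y > 1) \<longrightarrow> card R \<le> N"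
    using unit_ball_packing by (rule exE)
  have betti: "reduced_betti TYPE('k) 1 (vietoris_rips S) \<le> N * n"
    if S: "finite S" "card S \<le> n" for S :: "(real^'d) set" and n
  proof -
    obtain T :: "((real^'d) list \<Rightarrow> 'k) set" where T: "finite T" "card T \<le> N * card S"
      "T \<subseteq> cycles (vietoris_rips S) 1"
      "cycles (vietoris_rips S) 1 \<subseteq> fun_space.span (T \<union> boundaries (vietoris_rips S) 1)"
      using cycles_spanned[OF S(1) N] by blast
    have "reduced_betti TYPE('k) 1 (vietoris_rips S) \<le> card T"
      unfolding reduced_betti_def reduced_homology_def
      using T by (intro dim_quotient_function_module_le subspace_cycles subspace_boundaries)
    also have "\<dots> \<le> N * n" using T(2) S(2) by (meson le_trans mult_le_mono2)
    finally show ?thesis .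
  qed
  have "max_betti TYPE('k) TYPE('d) 1 n \<le> N * n" for n
  proof -
    let ?B = "{reduced_betti TYPE('k) 1 (vietoris_rips S) | S :: (real^'d) set. finite S \<and> card S \<le> n}"
    \<comment> \<open>\<open>Max\<close> needs a finite nonempty set: the uniform bound leaves
      finitely many values even if there are infinitely many \<open>S\<close>, and the empty
      \<open>S\<close> provides one.\<close>
    have B: "\<forall>b\<in>?B. b \<le> N * n" using betti by blast
    moreover have "finite ?B" using B finite_nat_set_iff_bounded_le by blast
    moreover have "?B \<noteq> {}" by (auto intro!: exI[of _ "{}"])
    ultimately show ?thesis unfolding max_betti_def by (intro Max.boundedI) auto
  qed
  then show ?thesis by (metis of_nat_le_iff of_nat_mult)
qed

end
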